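(* Let $g_1\in\mathbb{C}[x]\setminus\mathbb{C}$ and $g_2,h_1\in\mathcal{L}\setminus\mathbb{C}$ satisfy $g_1\circ h_1=g_2\circ x^n$ with $n\in\mathbb{Z}_{>0}$. Then either $h_1=A\circ x^n$ (and $g_2=g_1\circ A$) for some $A\in\mathcal{L}$, or there exist $G,\mu\in\mathbb{C}[x]$ with $\mu$ linear such that $g_1=G\circ G_1\circ\mu$, $h_1=\mu^{-1}\circ H_1$, and $g_2=G\circ G_2$, where one of the following holds (with $e\in\mathbb{Z}$ and $r=\gcd(n,e)$): (1) $G_1=x^{n/r}$, $H_1=x^ep(x^n)$, and $G_2=x^{e/r}p(x)^{n/r}$, where $p\in\mathbb{C}[x]$; (2) $G_1=D_{n/r}$, $H_1=(x^e+1/x^e)\circ\alpha x$, and $G_2=(x^{e/r}+1/x^{e/r})\circ\alpha^nx$, where $\alpha\in\mathbb{C}^*$.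
   Context: $\mathcal{L}$ denotes the set of complex Laurent polynomials, i.e. rational functions $F(x)/x^k$ with $F\in\mathbb{C}[x]$, $k\in\mathbb{Z}_{\ge0}$. Composition is $(g\circ h)(x)=g(h(x))$, and $\mu^{-1}$ is the compositional inverse of a linear $\mu$. For $k\ge1$, the Dickson polynomial $D_k\in\mathbb{C}[x]$ is defined by $D_k(x+1/x)=x^k+1/x^k$. *)

theory Defs
  imports "HOL-Computational_Algebra.Computational_Algebra" "HOL-Computational_Algebra.Field_as_Ring"
begin

text \<open>
  Rational functions in one variable over the complex numbers are elements of
  \<^typ>\<open>complex poly fract\<close>, with \<^const>\<open>to_fract\<close> embedding the polynomials.
\<close>

type_synonym ratfun = "complex poly fract"

definition rat_const :: "complex \<Rightarrow> ratfun" where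
  "rat_const c = to_fract [:c:]"

definition rat_X :: ratfun where
  "rat_X = to_fract [:0, 1:]"

definition laurent_polys :: "ratfun set" where
  "laurent_polys = {to_fract F / rat_X ^ k | F k. True}"

text \<open>
  Substitution of \<open>h\<close> for the variable in numerator and denominator of \<open>g\<close>, where
  \<^const>\<open>quot_of_fract\<close> gives the representation in lowest terms with monic denominator.  The
  denominator can only vanish at \<open>h\<close> if \<open>g\<close> is not a polynomial and \<open>h\<close> is constant.
\<close>

definition rat_compose :: "ratfun \<Rightarrow> ratfun \<Rightarrow> ratfun" (infixl "\<circ>\<^sub>r" 71) where
  "g \<circ>\<^sub>r h = poly (map_poly rat_const (fst (quot_of_fract g))) h /
            poly (map_poly rat_const (snd (quot_of_fract g))) h"

definition linear_poly :: "complex poly \<Rightarrow> bool" where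
  "linear_poly \<mu> \<longleftrightarrow> degree \<mu> = 1"

definition comp_inv :: "complex poly \<Rightarrow> complex poly" where
  "comp_inv \<mu> = (THE \<nu>. \<mu> \<circ>\<^sub>p \<nu> = [:0, 1:] \<and> \<nu> \<circ>\<^sub>p \<mu> = [:0, 1:])"

definition dickson :: "nat \<Rightarrow> complex poly" where
  "dickson k = (THE D. to_fract D \<circ>\<^sub>r (rat_X + 1 / rat_X) = rat_X ^ k + 1 / rat_X ^ k)"

subsection \<open>Well-definedness\<close>

lemma rat_const_0 [simp]: "rat_const 0 = 0"
  and rat_const_1 [simp]: "rat_const 1 = 1"
  and rat_const_add: "rat_const (a + b) = rat_const a + rat_const b"
  and rat_const_minus: "rat_const (- a) = - rat_const a"
  and rat_const_mult: "rat_const (a * b) = rat_const a * rat_const b"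
  and rat_const_eq_0_iff [simp]: "rat_const a = 0 \<longleftrightarrow> a = 0"
  by (simp_all add: rat_const_def flip: to_fract_add to_fract_mult to_fract_uminus one_pCons)

lemma poly_const_pCons:
  "poly (map_poly rat_const (pCons a p)) h = rat_const a + h * poly (map_poly rat_const p) h"
  by (simp add: map_poly_pCons)

lemma poly_const_1: "poly (map_poly rat_const 1) h = 1"
  by (simp add: one_pCons poly_const_pCons)

lemma poly_const_add:
  "poly (map_poly rat_const (p + q)) h =
     poly (map_poly rat_const p) h + poly (map_poly rat_const q) h"
  by (induction p q rule: poly_induct2) (simp_all add: poly_const_pCons rat_const_add algebra_simps)

lemma poly_const_smult:
  "poly (map_poly rat_const (smult c p)) h = rat_const c * poly (map_poly rat_const p) h"
  by (induction p) (simp_all add: poly_const_pCons rat_const_mult algebra_simps)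

lemma poly_const_mult:
  "poly (map_poly rat_const (p * q)) h =
     poly (map_poly rat_const p) h * poly (map_poly rat_const q) h"
  by (induction p)
     (simp_all add: poly_const_pCons poly_const_add poly_const_smult algebra_simps)

lemma poly_const_diff:
  "poly (map_poly rat_const (p - q)) h =
     poly (map_poly rat_const p) h - poly (map_poly rat_const q) h"
  using poly_const_add[of "p - q" q h] by (simp add: algebra_simps)

lemma poly_const_nonzero:
  assumes "h \<notin> range rat_const" "q \<noteq> 0"
  shows "poly (map_poly rat_const q) h \<noteq> 0"
  using assms(2)
proof (induction "degree q" arbitrary: q rule: less_induct)
  case less
  show ?case
  proof (cases "degree q = 0")
    case True
    then obtain c where "q = [:c:]" by (rule degree_eq_zeroE)
    with less.prems show ?thesis by (simp add: poly_const_pCons)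
  next
    case False
    then obtain a where "poly q a = 0"
      using fundamental_theorem_of_algebra[of q] by (auto simp: constant_degree)
    then obtain s where s: "q = [:- a, 1:] * s" by (auto simp: poly_eq_0_iff_dvd dvd_def)
    with less.prems have "s \<noteq> 0" by auto
    then have "degree ([:- a, 1:] * s) = Suc (degree s)" by (subst degree_mult_eq) simp_all
    then have "degree s < degree q" using s by simp
    with less.hyps \<open>s \<noteq> 0\<close> have "poly (map_poly rat_const s) h \<noteq> 0" by blast
    moreover have "poly (map_poly rat_const [:- a, 1:]) h \<noteq> 0"
      using assms(1) by (auto simp: poly_const_pCons rat_const_minus)
    ultimately show ?thesis unfolding s poly_const_mult by simp
  qed
qed

lemma to_fract_rat_compose: "to_fract p \<circ>\<^sub>r h = poly (map_poly rat_const p) h"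
proof -
  have "quot_of_fract (to_fract p) = (p, 1)"
    using snd_quot_of_fract_to_fract[of p] fst_quot_of_fract_eq_0_iff
    by (metis fract_collapse(1) Fract_quot_of_fract to_fract_def to_fract_eq_iff prod.collapse)
  then show ?thesis by (simp add: rat_compose_def poly_const_1)
qed

lemma rat_compose_Fract:
  assumes "h \<notin> range rat_const" "q \<noteq> 0"
  shows "Fract p q \<circ>\<^sub>r h = poly (map_poly rat_const p) h / poly (map_poly rat_const q) h"
proof -
  define a b where "a = fst (quot_of_fract (Fract p q))" and "b = snd (quot_of_fract (Fract p q))"
  have "b \<noteq> 0" unfolding b_def by simp
  have "Fract a b = Fract p q" unfolding a_def b_def by simp
  with \<open>b \<noteq> 0\<close> assms(2) have "a * q = p * b" by (simp add: eq_fract)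
  then have "poly (map_poly rat_const a) h * poly (map_poly rat_const q) h =
             poly (map_poly rat_const p) h * poly (map_poly rat_const b) h"
    by (simp flip: poly_const_mult)
  with poly_const_nonzero[OF assms(1) \<open>b \<noteq> 0\<close>] poly_const_nonzero[OF assms]
  show ?thesis by (simp add: rat_compose_def divide_simps flip: a_def b_def)
qed

lemma to_fract_rat_compose_to_fract: "to_fract p \<circ>\<^sub>r to_fract q = to_fract (p \<circ>\<^sub>p q)"
  unfolding to_fract_rat_compose
  by (induction p) (simp_all add: poly_const_pCons pcompose_pCons, simp add: rat_const_def)

lemma comp_inv_linear:
  assumes "a \<noteq> 0"
  shows "comp_inv [:b, a:] = [:- b / a, 1 / a:]"
  unfolding comp_inv_def
proof (rule the_equality)
  show inv: "[:b, a:] \<circ>\<^sub>p [:- b / a, 1 / a:] = [:0, 1:] \<and> [:- b / a, 1 / a:] \<circ>\<^sub>p [:b, a:] = [:0, 1:]"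
    using assms by (simp add: pcompose_pCons)
  fix \<nu> assume \<nu>: "[:b, a:] \<circ>\<^sub>p \<nu> = [:0, 1:] \<and> \<nu> \<circ>\<^sub>p [:b, a:] = [:0, 1:]"
  have id: "p \<circ>\<^sub>p [:0, 1:] = p" "[:0, 1:] \<circ>\<^sub>p p = p" for p :: "complex poly"
    by (simp_all add: pcompose_idR pcompose_pCons)
  from \<nu> inv id show "\<nu> = [:- b / a, 1 / a:]" by (metis pcompose_assoc)
qed

lemma rat_X_nonzero [simp]: "rat_X \<noteq> 0"
  by (simp add: rat_X_def)

lemma rat_X_plus_inverse_not_const: "rat_X + 1 / rat_X \<notin> range rat_const"
proof
  assume "rat_X + 1 / rat_X \<in> range rat_const"
  then obtain c where "rat_X + 1 / rat_X = rat_const c" by auto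
  then have "rat_X * rat_X + 1 = rat_const c * rat_X" by (simp add: field_simps)
  then have "to_fract ([:0, 1:] * [:0, 1:] + 1) = to_fract ([:c:] * [:0, 1:])"
    by (simp only: rat_X_def rat_const_def to_fract_add to_fract_mult to_fract_1)
  then show False by (simp add: one_pCons)
qed

lemma dickson_ex1:
  "\<exists>!D. to_fract D \<circ>\<^sub>r (rat_X + 1 / rat_X) = rat_X ^ k + 1 / rat_X ^ k"
proof (rule ex_ex1I)
  let ?h = "rat_X + 1 / rat_X"
  have "\<exists>D E. to_fract D \<circ>\<^sub>r ?h = rat_X ^ k + 1 / rat_X ^ k \<and>
              to_fract E \<circ>\<^sub>r ?h = rat_X ^ Suc k + 1 / rat_X ^ Suc k"
  proof (induction k)
    case 0
    have "to_fract [:2:] \<circ>\<^sub>r ?h = rat_X ^ 0 + 1 / rat_X ^ 0"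
      using rat_const_add[of 1 1] by (simp add: to_fract_rat_compose poly_const_pCons)
    moreover have "to_fract [:0, 1:] \<circ>\<^sub>r ?h = rat_X ^ Suc 0 + 1 / rat_X ^ Suc 0"
      by (simp add: to_fract_rat_compose poly_const_pCons)
    ultimately show ?case by blast
  next
    case (Suc k)
    then obtain D E where D: "to_fract D \<circ>\<^sub>r ?h = rat_X ^ k + 1 / rat_X ^ k"
      and E: "to_fract E \<circ>\<^sub>r ?h = rat_X ^ Suc k + 1 / rat_X ^ Suc k" by blast
    have "to_fract ([:0, 1:] * E - D) \<circ>\<^sub>r ?h = ?h * (to_fract E \<circ>\<^sub>r ?h) - to_fract D \<circ>\<^sub>r ?h"
      unfolding to_fract_rat_compose poly_const_diff poly_const_mult
      by (simp add: poly_const_pCons)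
    also have "\<dots> = rat_X ^ Suc (Suc k) + 1 / rat_X ^ Suc (Suc k)"
      unfolding D E by (simp add: field_simps)
    finally show ?case using E by blast
  qed
  then show "\<exists>D. to_fract D \<circ>\<^sub>r ?h = rat_X ^ k + 1 / rat_X ^ k" by blast
  fix D E assume "to_fract D \<circ>\<^sub>r ?h = rat_X ^ k + 1 / rat_X ^ k"
    and "to_fract E \<circ>\<^sub>r ?h = rat_X ^ k + 1 / rat_X ^ k"
  then have "poly (map_poly rat_const (D - E)) ?h = 0"
    by (simp add: to_fract_rat_compose poly_const_diff)
  then show "D = E" using poly_const_nonzero[OF rat_X_plus_inverse_not_const, of "D - E"] by auto
qed

end

theory Submission
  imports Defs
begin

text \<open>
  Let \<open>\<zeta>\<close> be a primitive \<open>n\<close>-th root of unity, and translate so that \<open>g\<^sub>1\<close>, of degree \<open>d\<close>, has no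
  term of degree \<open>d - 1\<close>; let \<open>h\<close> be the translated \<open>h\<^sub>1\<close>.  The hypothesis says that
  \<open>g\<^sub>1(h(\<zeta>x)) = g\<^sub>1(h(x))\<close>.  If \<open>h\<close> has a pole of order \<open>m\<close> at infinity, comparing \<open>d\<close>-th roots of the two sides there gives
  \<open>h(\<zeta>x) - \<zeta>\<^sup>m h(x) = O(x\<^sup>-\<^sup>m)\<close>, so every exponent \<open>i > -m\<close> of \<open>h\<close> satisfies \<open>\<zeta>\<^sup>i = \<zeta>\<^sup>m\<close>; likewise at
  the origin.  Combining both, either all exponents of \<open>h\<close> agree modulo \<open>n\<close>, which gives case (1), or
  \<open>h\<close> is a binomial in \<open>x\<^sup>m\<close> and \<open>x\<^sup>-\<^sup>m\<close>, which rescales to \<open>y\<^sup>m + y\<^sup>-\<^sup>m\<close> and gives case (2).  In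
  both cases the polynomials \<open>g\<close> with \<open>g(h(\<zeta>x)) = g(h(x))\<close> are those in \<open>G\<^sub>1\<close>: their degrees are
  divisible by \<open>deg G\<^sub>1\<close>, so powers of \<open>G\<^sub>1\<close> can be subtracted off one after the other.  The first
  alternative of the theorem is subsumed by case (1) with \<open>r = n\<close>.
\<close>

section \<open>Constants and monomials among the rational functions\<close>

lemma to_fract_power: "to_fract (a ^ n) = to_fract a ^ n"
  by (induction n) simp_all

lemma rat_const_power: "rat_const (a ^ n) = rat_const a ^ n"
  by (induction n) (simp_all add: rat_const_mult)

lemma rat_const_inverse: "rat_const (inverse a) = inverse (rat_const a)"
proof (cases "a = 0")
  case False
  then have "rat_const a * rat_const (inverse a) = 1"
    by (simp flip: rat_const_mult)
  then show ?thesis by (metis inverse_unique)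
qed simp

lemma rat_const_divide: "rat_const (a / b) = rat_const a / rat_const b"
  by (simp add: divide_inverse rat_const_mult rat_const_inverse)

lemma to_fract_monom: "to_fract (monom c k) = rat_const c * rat_X ^ k"
proof (induction k)
  case (Suc k)
  have "monom c (Suc k) = [:0, 1:] * monom c k" by (simp add: monom_Suc)
  then show ?case by (simp only: to_fract_mult Suc power_Suc mult.left_commute flip: rat_X_def)
qed (simp add: monom_0 rat_const_def)

lemma rat_compose_const [simp]: "rat_const c \<circ>\<^sub>r h = rat_const c"
proof -
  have "rat_const c \<circ>\<^sub>r h = poly (map_poly rat_const [:c:]) h"
    unfolding to_fract_rat_compose[symmetric] by (simp add: rat_const_def)
  then show ?thesis by (simp add: poly_const_pCons)
qed

lemma rat_compose_X [simp]: "rat_X \<circ>\<^sub>r h = h"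
  unfolding rat_X_def to_fract_rat_compose by (simp add: poly_const_pCons)

lemma rat_compose_0 [simp]: "0 \<circ>\<^sub>r h = 0"
  and rat_compose_1 [simp]: "1 \<circ>\<^sub>r h = 1"
  using rat_compose_const[of 0 h] rat_compose_const[of 1 h] by simp_all

section \<open>Right composition with a nonconstant function as a field embedding\<close>

context
  fixes h :: ratfun
  assumes h: "h \<notin> range rat_const"
begin

lemma rat_compose_mult: "(a * b) \<circ>\<^sub>r h = (a \<circ>\<^sub>r h) * (b \<circ>\<^sub>r h)"
proof (cases a, cases b)
  fix p q p' q' assume *: "a = Fract p q" "q \<noteq> 0" "b = Fract p' q'" "q' \<noteq> 0"
  then show ?thesis
    by (simp add: rat_compose_Fract[OF h] poly_const_mult)
qed

lemma rat_compose_add: "(a + b) \<circ>\<^sub>r h = (a \<circ>\<^sub>r h) + (b \<circ>\<^sub>r h)"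
proof (cases a, cases b)
  fix p q p' q' assume *: "a = Fract p q" "q \<noteq> 0" "b = Fract p' q'" "q' \<noteq> 0"
  then show ?thesis
    using poly_const_nonzero[OF h]
    by (simp add: rat_compose_Fract[OF h] poly_const_mult poly_const_add add_frac_eq)
qed

lemma rat_compose_inverse: "inverse a \<circ>\<^sub>r h = inverse (a \<circ>\<^sub>r h)"
proof (cases "a = 0")
  case False
  then have "(a \<circ>\<^sub>r h) * (inverse a \<circ>\<^sub>r h) = 1"
    by (simp flip: rat_compose_mult)
  then show ?thesis by (metis inverse_unique)
qed simp

lemma rat_compose_divide: "(a / b) \<circ>\<^sub>r h = (a \<circ>\<^sub>r h) / (b \<circ>\<^sub>r h)"
  by (simp add: divide_inverse rat_compose_mult rat_compose_inverse)

lemma rat_compose_minus: "(- a) \<circ>\<^sub>r h = - (a \<circ>\<^sub>r h)"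
  using rat_compose_add[of a "- a"] by (simp add: minus_unique)

lemma rat_compose_diff: "(a - b) \<circ>\<^sub>r h = (a \<circ>\<^sub>r h) - (b \<circ>\<^sub>r h)"
  using rat_compose_add[of a "- b"] by (simp add: rat_compose_minus)

lemma rat_compose_power: "(a ^ k) \<circ>\<^sub>r h = (a \<circ>\<^sub>r h) ^ k"
  by (induction k) (simp_all add: rat_compose_mult)

lemma rat_compose_power_int: "(a powi k) \<circ>\<^sub>r h = (a \<circ>\<^sub>r h) powi k"
  by (simp add: power_int_def rat_compose_power rat_compose_inverse)

text \<open>A nonzero difference has an inverse, and composition preserves their product 1, so the
  difference cannot be sent to 0. This is what later permits cancelling \<open>rat_X ^ n\<close> and
  \<open>H0\<close> on the right.\<close>

lemma rat_compose_eq_iff: "a \<circ>\<^sub>r h = b \<circ>\<^sub>r h \<longleftrightarrow> a = b"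
proof
  assume eq: "a \<circ>\<^sub>r h = b \<circ>\<^sub>r h"
  show "a = b"
  proof (rule ccontr)
    assume "a \<noteq> b"
    then have "(a - b) * inverse (a - b) = 1" by simp
    then have "((a - b) \<circ>\<^sub>r h) * (inverse (a - b) \<circ>\<^sub>r h) = 1"
      by (simp flip: rat_compose_mult)
    then show False using eq by (simp add: rat_compose_diff)
  qed
qed simp

text \<open>A polynomial on the left has no denominator that could vanish, so \<open>g\<close> may
  be constant here, in contrast to \<open>rat_compose_assoc\<close>.\<close>

lemma to_fract_rat_compose_assoc: "(to_fract p \<circ>\<^sub>r g) \<circ>\<^sub>r h = to_fract p \<circ>\<^sub>r (g \<circ>\<^sub>r h)"
  unfolding to_fract_rat_compose
  by (induction p) (simp_all add: poly_const_pCons rat_compose_add rat_compose_mult)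

lemma rat_compose_notin_range:
  assumes "g \<notin> range rat_const"
  shows "g \<circ>\<^sub>r h \<notin> range rat_const"
proof
  assume "g \<circ>\<^sub>r h \<in> range rat_const"
  then obtain c where "g \<circ>\<^sub>r h = rat_const c \<circ>\<^sub>r h" by auto
  then have "g = rat_const c" by (simp only: rat_compose_eq_iff)
  with assms show False by blast
qed

lemma rat_compose_assoc:
  assumes "g \<notin> range rat_const"
  shows "(f \<circ>\<^sub>r g) \<circ>\<^sub>r h = f \<circ>\<^sub>r (g \<circ>\<^sub>r h)"
proof (cases f)
  case (Fract p q)
  then show ?thesis
    using assms rat_compose_notin_range[OF assms]
    by (simp add: rat_compose_Fract rat_compose_divide to_fract_rat_compose_assoc
             flip: to_fract_rat_compose)
qed

end

lemma to_fract_rat_compose_inject: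
  assumes "h \<notin> range rat_const"
  shows "to_fract p \<circ>\<^sub>r h = to_fract q \<circ>\<^sub>r h \<longleftrightarrow> p = q"
  using rat_compose_eq_iff[OF assms] by simp

lemma to_fract_pcompose_rat_compose:
  "to_fract (p \<circ>\<^sub>p q) \<circ>\<^sub>r h = to_fract p \<circ>\<^sub>r (to_fract q \<circ>\<^sub>r h)"
  unfolding to_fract_rat_compose
  by (induction p) (simp_all add: pcompose_pCons poly_const_pCons poly_const_add poly_const_mult)

lemma to_fract_notin_range:
  assumes "degree p > 0"
  shows "to_fract p \<notin> range rat_const"
  using assms by (auto simp: rat_const_def)

lemma rat_X_power_notin_range:
  assumes "k > 0" "c \<noteq> 0"
  shows "rat_const c * rat_X ^ k \<notin> range rat_const"
  using to_fract_notin_range[of "monom c k"] assms by (simp add: degree_monom_eq to_fract_monom)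

lemma const_mult_rat_X_notin_range: "c \<noteq> 0 \<Longrightarrow> rat_const c * rat_X \<notin> range rat_const"
  using rat_X_power_notin_range[of 1 c] by simp

lemma rat_X_notin_range: "rat_X \<notin> range rat_const"
  using const_mult_rat_X_notin_range[of 1] by simp

lemma inverse_rat_X_notin_range: "inverse rat_X \<notin> range rat_const"
proof
  assume "inverse rat_X \<in> range rat_const"
  then obtain c where "inverse rat_X = rat_const c" by auto
  then have "rat_X = rat_const (inverse c)" by (metis inverse_inverse_eq rat_const_inverse)
  then show False using rat_X_notin_range by blast
qed

section \<open>Roots of unity\<close>

lemma exists_primitive_root_of_unity:
  assumes "n > 0"
  obtains \<zeta> :: complex where "\<And>j. \<zeta> ^ j = 1 \<longleftrightarrow> n dvd j"
proof
  fix j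
  let ?z = "\<lambda>k. cis (2 * pi * real k / real n)"
  have pow: "?z 1 ^ k = ?z k" for k by (simp add: DeMoivre field_simps)
  have n1: "?z 1 ^ n = 1" using assms by (simp add: DeMoivre)
  have "?z 1 ^ j = ?z 1 ^ (n * (j div n) + j mod n)" by simp
  also have "\<dots> = ?z (j mod n)" using n1 pow by (simp only: power_add power_mult) simp
  finally have "?z 1 ^ j = 1 \<longleftrightarrow> ?z (j mod n) = ?z 0" by simp
  \<comment> \<open>Indices below \<open>n\<close> give pairwise distinct roots, so only the index 0
    gives 1.\<close>
  also have "\<dots> \<longleftrightarrow> j mod n = 0"
    using bij_betw_roots_unity[OF assms] assms
    by (auto simp: bij_betw_def dest!: inj_onD[where x = "j mod n" and y = 0])
  finally show "?z 1 ^ j = 1 \<longleftrightarrow> n dvd j" by (simp add: dvd_eq_mod_eq_0)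
qed

lemma power_int_eq_1_iff_dvd:
  fixes \<zeta> :: complex
  assumes "\<And>j. \<zeta> ^ j = 1 \<longleftrightarrow> n dvd j"
  shows "\<zeta> powi i = 1 \<longleftrightarrow> int n dvd i"
proof -
  have "\<zeta> powi i = 1 \<longleftrightarrow> \<zeta> ^ nat \<bar>i\<bar> = 1"
    by (auto simp: power_int_def inverse_eq_1_iff power_inverse)
  then show ?thesis by (simp add: assms)
qed

section \<open>Clearing denominators and comparing expansions at infinity\<close>

lemma homogenize_rat_compose:
  fixes g F A :: "complex poly"
  assumes "A \<noteq> 0"
  shows "(to_fract g \<circ>\<^sub>r (to_fract F / to_fract A)) * to_fract A ^ degree g =
    to_fract (\<Sum>i\<le>degree g. smult (coeff g i) (F ^ i * A ^ (degree g - i)))"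
proof -
  have deg: "degree (map_poly rat_const g) = degree g"
    by (rule degree_map_poly) simp
  have smult: "to_fract (smult c p) = rat_const c * to_fract p" for c p
    by (simp add: rat_const_def flip: to_fract_mult)
  show ?thesis
    unfolding to_fract_rat_compose poly_altdef deg sum_distrib_right to_fract_sum
  proof (rule sum.cong)
    fix i assume "i \<in> {..degree g}"
    then have "to_fract A ^ degree g = to_fract A ^ i * to_fract A ^ (degree g - i)"
      by (simp flip: power_add)
    then show "coeff (map_poly rat_const g) i * (to_fract F / to_fract A) ^ i * to_fract A ^ degree g =
      to_fract (smult (coeff g i) (F ^ i * A ^ (degree g - i)))"
      using assms by (simp add: coeff_map_poly smult to_fract_power power_divide)
  qed simp
qed

text \<open>As \<open>A\<close> has smaller degree than \<open>F\<close>, each factor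
  \<open>F\<close> replaced by \<open>A\<close> lowers the degree, so only the summand
  \<open>i = degree g\<close> reaches the top position.\<close>

lemma coeff_homogenize:
  fixes g F A :: "'a::idom poly"
  assumes "degree A < degree F"
  shows "coeff (\<Sum>i\<le>degree g. smult (coeff g i) (F ^ i * A ^ (degree g - i))) (degree F * degree g) =
    lead_coeff g * lead_coeff F ^ degree g"
proof -
  let ?d = "degree g"
  have "coeff (smult (coeff g i) (F ^ i * A ^ (?d - i))) (degree F * ?d) = 0" if "i < ?d" for i
  proof -
    have "degree (F ^ i * A ^ (?d - i)) \<le> degree F * i + degree A * (?d - i)"
      by (intro order_trans[OF degree_mult_le] add_mono degree_power_le)
    also have "\<dots> < degree F * i + degree F * (?d - i)"
      using that assms by simp
    also have "\<dots> = degree F * ?d" using that by (simp flip: distrib_left)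
    finally show ?thesis by (simp add: coeff_eq_0)
  qed
  then have "(\<Sum>i<?d. coeff (smult (coeff g i) (F ^ i * A ^ (?d - i))) (degree F * ?d)) = 0"
    by (intro sum.neutral) blast
  moreover have "coeff (F ^ ?d) (degree F * ?d) = lead_coeff F ^ ?d"
    by (metis degree_power_eq lead_coeff_power degree_0 assms not_less0 mult.commute)
  ultimately show ?thesis
    by (simp add: coeff_sum flip: lessThan_Suc_atMost)
qed

text \<open>
  With the second highest coefficient of \<open>g\<close> gone, \<open>F\<^sub>1\<^sup>d - (\<omega> F\<^sub>2)\<^sup>d\<close> has low degree, while its
  cofactor of \<open>F\<^sub>1 - \<omega> F\<^sub>2\<close> has the full degree \<open>M (d - 1)\<close>.
\<close>
lemma degree_diff_smult_le:
  fixes g F1 F2 A :: "complex poly"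
  assumes eq: "(\<Sum>i\<le>degree g. smult (coeff g i) (F1 ^ i * A ^ (degree g - i))) =
               (\<Sum>i\<le>degree g. smult (coeff g i) (F2 ^ i * A ^ (degree g - i)))"
    and deg: "degree A < M" "degree F1 = M" "degree F2 = M"
    and lead: "lead_coeff F1 = \<omega> * lead_coeff F2"
    and g: "degree g > 0" "coeff g (degree g - 1) = 0"
    and ne: "F1 \<noteq> smult \<omega> F2"
  shows "degree (F1 - smult \<omega> F2) + M \<le> 2 * degree A"
proof -
  define d where "d = degree g"
  define c where "c = lead_coeff g"
  have c: "c \<noteq> 0" using g unfolding c_def by auto
  have F: "F1 \<noteq> 0" "F2 \<noteq> 0" using deg by auto
  have \<omega>0: "\<omega> \<noteq> 0" using lead F by auto
  have "lead_coeff F1 ^ d = lead_coeff F2 ^ d"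
    using coeff_homogenize[of A F1 g] coeff_homogenize[of A F2 g] eq deg c
    by (simp add: c_def d_def)
  then have \<omega>: "\<omega> ^ d = 1" using lead F by (simp add: power_mult_distrib)
  define E where "E = smult \<omega> F2"
  \<comment> \<open>Up to sign, \<open>R\<close> is the contribution of the lower terms of
    \<open>g\<close> to the difference of the two sides; by \<open>eq\<close> it equals the
    contribution of the top term. Its degree is now computed from the top term and bounded through
    the lower ones.\<close>
  define R where "R = (\<Sum>i<d. smult (coeff g i) ((F2 ^ i - F1 ^ i) * A ^ (d - i)))"
  define S where "S = (\<Sum>i<d. E ^ (d - Suc i) * F1 ^ i)"
  have E: "degree E = M" "lead_coeff E = lead_coeff F1"
    using \<omega>0 deg lead by (simp_all add: E_def)
  have "E ^ d = F2 ^ d"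
    using smult_power[of \<omega> F2 d] \<omega> by (simp add: E_def)
  then have ER: "smult c (F1 ^ d - E ^ d) = R"
    using eq unfolding R_def
    by (simp add: c_def d_def algebra_simps sum_subtractf smult_diff_right
             flip: lessThan_Suc_atMost)
  have fac: "F1 ^ d - E ^ d = (F1 - E) * S"
    unfolding S_def by (rule power_diff_sumr2)
  have degS: "degree S \<le> M * (d - 1)"
    unfolding S_def
  proof (rule degree_sum_le)
    fix i assume "i \<in> {..<d}"
    then have "M * (d - Suc i) + M * i = M * (d - 1)" by (simp flip: distrib_left)
    moreover have "degree (E ^ (d - Suc i) * F1 ^ i) \<le> degree E * (d - Suc i) + degree F1 * i"
      by (intro order_trans[OF degree_mult_le] add_mono degree_power_le)
    ultimately show "degree (E ^ (d - Suc i) * F1 ^ i) \<le> M * (d - 1)" using E deg by simp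
  qed simp
  \<comment> \<open>\<open>E\<close> and \<open>F1\<close> share degree and leading coefficient, so
    all \<open>d\<close> summands of \<open>S\<close> have the same leading term and cannot cancel
    in characteristic 0.\<close>
  have "coeff S (M * (d - 1)) = (\<Sum>i<d. lead_coeff F1 ^ (d - 1))"
    unfolding S_def coeff_sum
  proof (rule sum.cong)
    fix i assume i: "i \<in> {..<d}"
    then have "degree (E ^ (d - Suc i) * F1 ^ i) = M * (d - Suc i) + M * i"
      using E F deg \<omega>0 by (subst degree_mult_eq) (auto simp: degree_power_eq E_def)
    also have "\<dots> = M * (d - 1)" using i by (simp flip: distrib_left)
    finally have "coeff (E ^ (d - Suc i) * F1 ^ i) (M * (d - 1)) =
        lead_coeff (E ^ (d - Suc i) * F1 ^ i)" by simp
    also have "\<dots> = lead_coeff F1 ^ (d - Suc i + i)"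
      by (simp only: lead_coeff_mult lead_coeff_power E(2) power_add)
    also have "d - Suc i + i = d - 1" using i by simp
    finally show "coeff (E ^ (d - Suc i) * F1 ^ i) (M * (d - 1)) = lead_coeff F1 ^ (d - 1)" .
  qed simp
  also have "\<dots> \<noteq> 0" using g F by (simp add: d_def)
  finally have S: "degree S = M * (d - 1)" "S \<noteq> 0"
    using degS le_degree[of S] by (auto intro: antisym)
  have nz: "F1 - E \<noteq> 0" using ne by (simp add: E_def)
  have degR: "degree R = degree (F1 - E) + M * (d - 1)"
    using nz S c by (simp add: ER[symmetric] fac degree_mult_eq)
  have "R \<noteq> 0" using nz S c by (simp add: ER[symmetric] fac)
  \<comment> \<open>The summand \<open>i = d - 1\<close> drops out because that coefficient of
    \<open>g\<close> is 0; each remaining one carries at least two factors \<open>A\<close>.\<close>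
  moreover have "R = (\<Sum>i<d - 1. smult (coeff g i) ((F2 ^ i - F1 ^ i) * A ^ (d - i)))"
    using g unfolding R_def by (cases d) (auto simp: d_def)
  \<comment> \<open>Otherwise the sum would be empty although \<open>R\<close> is nonzero. Hence the
    subtraction in \<open>d - 2\<close> below is not truncated.\<close>
  ultimately have "d - 1 > 0" by (intro Nat.gr0I) auto
  have "degree R \<le> M * (d - 2) + 2 * degree A"
    unfolding \<open>R = (\<Sum>i<d - 1. _ i)\<close>
  proof (rule degree_sum_le)
    fix i assume i: "i \<in> {..<d - 1}"
    have "degree (F2 ^ i - F1 ^ i) \<le> M * i"
      using deg degree_power_le[of F1 i] degree_power_le[of F2 i] by (intro degree_diff_le) auto
    then have "degree (smult (coeff g i) ((F2 ^ i - F1 ^ i) * A ^ (d - i))) \<le>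
        M * i + degree A * (d - i)"
      using degree_smult_le[of "coeff g i" "(F2 ^ i - F1 ^ i) * A ^ (d - i)"]
        degree_mult_le[of "F2 ^ i - F1 ^ i" "A ^ (d - i)"] degree_power_le[of A "d - i"]
      by linarith
    \<comment> \<open>Two factors \<open>A\<close> are kept exactly, all others are bounded by
      degree \<open>M\<close>.\<close>
    also have "M * i + degree A * (d - i) = M * i + degree A * ((d - 2 - i) + 2)"
    proof -
      have "d - i = d - 2 - i + 2" using i by auto
      then show ?thesis by (simp only:)
    qed
    also have "\<dots> \<le> M * i + (M * (d - 2 - i) + 2 * degree A)"
      using deg by (simp add: distrib_left)
    also have "\<dots> = M * (i + (d - 2 - i)) + 2 * degree A" by (simp add: distrib_left)
    also have "i + (d - 2 - i) = d - 2" using i by auto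
    finally show "degree (smult (coeff g i) ((F2 ^ i - F1 ^ i) * A ^ (d - i))) \<le>
        M * (d - 2) + 2 * degree A" .
  qed simp
  moreover have "M * (d - 1) = M * (d - 2) + M"
  proof -
    have "d - 1 = Suc (d - 2)" using \<open>d - 1 > 0\<close> by simp
    then show ?thesis by (simp only: mult_Suc_right add.commute)
  qed
  ultimately show ?thesis using degR by (simp add: E_def)
qed

text \<open>Here \<open>degree F + l\<close> is the pole order of \<open>h\<close> at infinity.
  Comparing leading coefficients gives the first claim, and \<open>degree_diff_smult_le\<close> the
  second: the condition on \<open>j\<close> says that the exponent \<open>j + l\<close> of
  \<open>h\<close> exceeds minus the pole order.\<close>

lemma
  fixes F g :: "complex poly" and l :: int
  assumes h: "h = rat_X powi l * to_fract F" and "F \<noteq> 0"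
    and pole: "int (degree F) + l > 0" and \<zeta>: "\<zeta> \<noteq> 0" and g: "degree g > 0"
    and inv: "to_fract g \<circ>\<^sub>r (h \<circ>\<^sub>r (rat_const \<zeta> * rat_X)) = to_fract g \<circ>\<^sub>r h"
  shows leading_exponent_symmetry: "(\<zeta> powi (int (degree F) + l)) ^ degree g = 1"
    and exponents_symmetry_at_infinity:
      "\<And>j. coeff g (degree g - 1) = 0 \<Longrightarrow> coeff F j \<noteq> 0 \<Longrightarrow>
        int j > - 2 * l - int (degree F) \<Longrightarrow> \<zeta> ^ j = \<zeta> ^ degree F"
proof -
  define a b where "a = nat l" and "b = nat (- l)"
  have l: "l = int a - int b" by (simp add: a_def b_def)
  define Y where "Y = rat_const \<zeta> * rat_X"
  have Y: "Y \<notin> range rat_const" "Y = to_fract [:0, \<zeta>:]"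
    using \<zeta> const_mult_rat_X_notin_range to_fract_monom[of \<zeta> 1]
    by (simp_all add: Y_def monom_altdef)
  define P where "P = monom 1 a * F"
  \<comment> \<open>\<open>h\<close> is \<open>P\<close> over \<open>rat_X ^ b\<close>. The common
    denominator of \<open>h\<close> and of \<open>h\<close> composed with \<open>Y\<close> is taken
    to be \<open>Y ^ b\<close>, and the factor \<open>\<zeta> ^ b\<close> in \<open>F2\<close>
    compensates for this.\<close>
  define A where "A = smult (\<zeta> ^ b) (monom 1 b)"
  define F1 where "F1 = P \<circ>\<^sub>p [:0, \<zeta>:]"
  define F2 where "F2 = smult (\<zeta> ^ b) P"
  define M where "M = a + degree F"
  have degP: "degree P = M" "P \<noteq> 0"
    using \<open>F \<noteq> 0\<close> by (simp_all add: P_def M_def degree_mult_eq degree_monom_eq)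
  have A: "degree A = b" "A \<noteq> 0" using \<zeta> by (simp_all add: A_def degree_monom_eq)
  have "b < M" using pole l by (simp add: M_def)
  have deg: "degree F1 = M" "degree F2 = M"
    using \<zeta> degP by (simp_all add: F1_def F2_def degree_pcompose)
  have lead: "lead_coeff F1 = \<zeta> ^ M * lead_coeff P" "lead_coeff F2 = \<zeta> ^ b * lead_coeff P"
    using \<zeta> degP deg by (simp_all add: F1_def F2_def coeff_pcompose_linear)
  have toA: "to_fract A = Y ^ b"
    by (simp add: A_def Y_def to_fract_monom smult_monom rat_const_power power_mult_distrib)
  have hP: "h = to_fract P / rat_X ^ b"
    unfolding h l P_def by (simp add: power_int_diff to_fract_monom)
  have toF2: "h = to_fract F2 / to_fract A"
  proof -
    have "to_fract F2 = to_fract (monom (\<zeta> ^ b) 0 * P)" by (simp add: F2_def monom_0)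
    then show ?thesis
      using \<zeta> unfolding toA hP Y_def
      by (simp add: to_fract_monom power_mult_distrib rat_const_power)
  qed
  have toF1: "h \<circ>\<^sub>r Y = to_fract F1 / to_fract A"
    unfolding hP rat_compose_divide[OF Y(1)] rat_compose_power[OF Y(1)] rat_compose_X toA
    by (subst (1) Y(2)) (simp only: to_fract_rat_compose_to_fract F1_def)
  have "to_fract (\<Sum>i\<le>degree g. smult (coeff g i) (F1 ^ i * A ^ (degree g - i))) =
        to_fract (\<Sum>i\<le>degree g. smult (coeff g i) (F2 ^ i * A ^ (degree g - i)))"
    unfolding homogenize_rat_compose[OF A(2), symmetric]
      toF1[symmetric] toF2[symmetric] inv[folded Y_def] ..
  then have eq: "(\<Sum>i\<le>degree g. smult (coeff g i) (F1 ^ i * A ^ (degree g - i))) =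
                 (\<Sum>i\<le>degree g. smult (coeff g i) (F2 ^ i * A ^ (degree g - i)))"
    by (simp only: to_fract_eq_iff)
  define \<omega> where "\<omega> = \<zeta> ^ M / \<zeta> ^ b"
  have lead12: "lead_coeff F1 = \<omega> * lead_coeff F2"
    using \<zeta> lead by (simp add: \<omega>_def)
  have "lead_coeff F1 ^ degree g = lead_coeff F2 ^ degree g"
    using coeff_homogenize[of A F1 g] coeff_homogenize[of A F2 g] eq deg g A \<open>b < M\<close> by auto
  then have "\<omega> ^ degree g = 1"
    using lead12 \<zeta> degP by (auto simp: power_mult_distrib F2_def)
  moreover have "\<omega> = \<zeta> powi (int (degree F) + l)"
    using \<zeta> by (simp add: \<omega>_def l M_def power_int_diff power_int_add power_add)
  ultimately show "(\<zeta> powi (int (degree F) + l)) ^ degree g = 1" by simp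
  fix j assume *: "coeff g (degree g - 1) = 0" "coeff F j \<noteq> 0" "int j > - 2 * l - int (degree F)"
  show "\<zeta> ^ j = \<zeta> ^ degree F"
  proof (rule ccontr)
    assume ne: "\<zeta> ^ j \<noteq> \<zeta> ^ degree F"
    \<comment> \<open>A violating \<open>j\<close> leaves a nonzero coefficient at
      \<open>a + j\<close>, which is too high for the degree bound.\<close>
    have "coeff (F1 - smult \<omega> F2) (a + j) = (\<zeta> ^ (a + j) - \<zeta> ^ M) * coeff F j"
      using \<zeta> by (simp add: F1_def F2_def coeff_pcompose_linear \<omega>_def P_def coeff_monom_mult
          left_diff_distrib)
    also have "\<dots> \<noteq> 0" using ne \<zeta> * by (simp add: M_def power_add)
    finally have "coeff (F1 - smult \<omega> F2) (a + j) \<noteq> 0" .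
    then have "a + j \<le> degree (F1 - smult \<omega> F2)" "F1 \<noteq> smult \<omega> F2"
      by (auto intro: le_degree)
    with degree_diff_smult_le[OF eq _ deg lead12 g *(1)] A \<open>b < M\<close>
    have "a + j + M \<le> 2 * b" by simp
    with * show False by (simp add: M_def l)
  qed
qed

section \<open>Passing to the origin, and the possible supports\<close>

lemma rat_compose_inverse_rat_X:
  "to_fract F \<circ>\<^sub>r inverse rat_X = to_fract (reflect_poly F) / rat_X ^ degree F"
proof -
  \<comment> \<open>Homogenizing with numerator 1 and denominator \<open>x\<close> reverses the
    coefficients.\<close>
  have "(\<Sum>i\<le>degree F. smult (coeff F i) (1 ^ i * [:0, 1:] ^ (degree F - i))) = reflect_poly F"
  proof (rule poly_eqI)
    fix k
    have "coeff (\<Sum>i\<le>degree F. smult (coeff F i) (1 ^ i * [:0, 1:] ^ (degree F - i))) k =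
      (\<Sum>i\<le>degree F. if i = degree F - k \<and> k \<le> degree F then coeff F i else 0)"
      unfolding coeff_sum
      by (intro sum.cong refl) (auto simp: coeff_monom simp flip: monom_altdef[of 1, simplified])
    also have "\<dots> = coeff (reflect_poly F) k"
      by (cases "k \<le> degree F") (auto simp: coeff_reflect_poly)
    finally show "coeff (\<Sum>i\<le>degree F. smult (coeff F i) (1 ^ i * [:0, 1:] ^ (degree F - i))) k =
      coeff (reflect_poly F) k" .
  qed
  moreover have "to_fract 1 / to_fract [:0, 1:] = inverse rat_X"
    by (simp add: rat_X_def divide_inverse)
  ultimately show ?thesis
    using homogenize_rat_compose[of "[:0, 1:]" F 1] by (simp add: eq_divide_eq flip: rat_X_def)
qed

text \<open>The information from infinity (\<open>P\<close>) and from the origin (\<open>Q\<close>)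
  each covers a range of exponents. Unless one range alone settles every exponent, the poles have
  equal order \<open>m\<close>, and both ranges contain all exponents strictly between
  \<open>- m\<close> and \<open>m\<close>.\<close>

lemma support_of_symmetric_laurent:
  fixes F g :: "complex poly" and l :: int
  assumes h: "h = rat_X powi l * to_fract F" "h \<notin> range rat_const" and F0: "coeff F 0 \<noteq> 0"
    and \<zeta>: "\<zeta> \<noteq> 0" and g: "degree g > 0" "coeff g (degree g - 1) = 0"
    and inv: "to_fract g \<circ>\<^sub>r (h \<circ>\<^sub>r (rat_const \<zeta> * rat_X)) = to_fract g \<circ>\<^sub>r h"
  shows "(\<forall>j. coeff F j \<noteq> 0 \<longrightarrow> \<zeta> ^ j = 1) \<or>
    (\<exists>m>0. l = - int m \<and> degree F = 2 * m \<and> (\<forall>j. 0 < j \<longrightarrow> j < 2 * m \<longrightarrow> coeff F j = 0))"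
proof -
  define N where "N = degree F"
  have "F \<noteq> 0" using F0 by auto
  then have FN: "coeff F N \<noteq> 0" by (simp add: N_def)
  have le_N: "j \<le> N" if "coeff F j \<noteq> 0" for j using that by (simp add: N_def le_degree)
  have P: "\<zeta> ^ j = \<zeta> ^ N" if "int N + l > 0" "coeff F j \<noteq> 0" "int N + 2 * l + int j > 0" for j
    using exponents_symmetry_at_infinity[OF h(1) \<open>F \<noteq> 0\<close> _ \<zeta> g(1) inv g(2), of j] that
    by (simp add: N_def)
  \<comment> \<open>This is \<open>P\<close> for \<open>h\<close> composed with \<open>1/x\<close>:
    the symmetry becomes the inverse of \<open>\<zeta>\<close>, and the coefficient at
    \<open>j\<close> moves to \<open>N - j\<close>.\<close>
  have Q: "\<zeta> ^ j = 1" if "l < 0" "coeff F j \<noteq> 0" "int j < - 2 * l" for j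
  proof -
    let ?I = "inverse rat_X" and ?F = "reflect_poly F"
    note I = inverse_rat_X_notin_range
    define Y where "Y = rat_const \<zeta> * rat_X"
    define Z where "Z = rat_const (inverse \<zeta>) * rat_X"
    have Y: "Y \<notin> range rat_const" and Z: "Z \<notin> range rat_const"
      using \<zeta> const_mult_rat_X_notin_range by (simp_all add: Y_def Z_def)
    have IZ: "?I \<circ>\<^sub>r Z = Y \<circ>\<^sub>r ?I"
      unfolding rat_compose_inverse[OF Z] Y_def rat_compose_mult[OF I]
      by (simp add: Z_def rat_const_inverse)
    have h': "h \<circ>\<^sub>r ?I = rat_X powi (- l - int N) * to_fract ?F"
      unfolding h(1) rat_compose_mult[OF I] rat_compose_power_int[OF I]
        rat_compose_inverse_rat_X
      by (simp add: N_def power_int_diff power_int_minus power_int_inverse)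
    have inv': "to_fract g \<circ>\<^sub>r ((h \<circ>\<^sub>r ?I) \<circ>\<^sub>r (rat_const (inverse \<zeta>) * rat_X)) = to_fract g \<circ>\<^sub>r (h \<circ>\<^sub>r ?I)"
    proof -
      have "(h \<circ>\<^sub>r ?I) \<circ>\<^sub>r Z = (h \<circ>\<^sub>r Y) \<circ>\<^sub>r ?I"
        by (simp add: rat_compose_assoc[OF Z I] rat_compose_assoc[OF I Y] IZ)
      then show ?thesis
        using inv by (simp flip: to_fract_rat_compose_assoc[OF I] Y_def Z_def)
    qed
    have deg: "degree ?F = N" using F0 by (simp add: N_def)
    have "?F \<noteq> 0" using \<open>F \<noteq> 0\<close> by simp
    have j: "j \<le> N" using that le_N by simp
    then have "coeff ?F (N - j) \<noteq> 0"
      using that by (simp add: coeff_reflect_poly N_def)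
    then have "inverse \<zeta> ^ (N - j) = inverse \<zeta> ^ N"
      using exponents_symmetry_at_infinity[OF h' \<open>?F \<noteq> 0\<close> _ _ g(1) inv' g(2), of "N - j"]
        that \<zeta> j by (simp add: deg of_nat_diff)
    then have "\<zeta> ^ (N - j) = \<zeta> ^ N" by (simp add: power_inverse)
    moreover have "\<zeta> ^ N = \<zeta> ^ (N - j) * \<zeta> ^ j" using j by (simp flip: power_add)
    ultimately show "\<zeta> ^ j = 1" using \<zeta> by simp
  qed
  show ?thesis
  proof (cases "\<forall>j. coeff F j \<noteq> 0 \<longrightarrow> \<zeta> ^ j = 1")
    case False
    then obtain j where j: "coeff F j \<noteq> 0" "\<zeta> ^ j \<noteq> 1" by blast
    \<comment> \<open>In this situation \<open>P\<close> reaches down to \<open>j = 0\<close>, where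
      it forces \<open>\<zeta> ^ N = 1\<close>.\<close>
    have 1: "\<not> (int N + l > 0 \<and> int N + 2 * l > 0)"
    proof
      assume *: "int N + l > 0 \<and> int N + 2 * l > 0"
      then have "\<zeta> ^ j = \<zeta> ^ N" "\<zeta> ^ 0 = \<zeta> ^ N" using P[of j] P[of 0] j F0 by auto
      with j show False by simp
    qed
    have 2: "\<not> (l < 0 \<and> int N < - 2 * l)"
      using Q[of j] j le_N[of j] by auto
    \<comment> \<open>Without a pole at infinity or at the origin, \<open>h\<close> would be
      constant.\<close>
    have "int N + l > 0 \<or> l < 0"
    proof (rule ccontr)
      assume "\<not> (int N + l > 0 \<or> l < 0)"
      then have "l = 0" "degree F = 0" by (auto simp: N_def)
      then have "h \<in> range rat_const"
        using h(1) by (auto simp: rat_const_def elim!: degree_eq_zeroE)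
      with h(2) show False by blast
    qed
    with 1 2 have l: "l < 0" "int N = - 2 * l" by auto
    have "\<zeta> ^ N \<noteq> 1"
      using P[of j] Q[of j] l j le_N[of j] by (cases "j = 0") auto
    \<comment> \<open>For a nonzero coefficient, \<open>P\<close> would give
      \<open>\<zeta> ^ i = \<zeta> ^ N\<close> and \<open>Q\<close> would give
      \<open>\<zeta> ^ i = 1\<close>.\<close>
    have "coeff F i = 0" if "0 < i" "i < N" for i
      using P[of i] Q[of i] l \<open>\<zeta> ^ N \<noteq> 1\<close> that by auto
    then have "nat (- l) > 0 \<and> l = - int (nat (- l)) \<and> degree F = 2 * nat (- l) \<and>
      (\<forall>j. 0 < j \<longrightarrow> j < 2 * nat (- l) \<longrightarrow> coeff F j = 0)"
      using l by (auto simp: N_def nat_mult_distrib)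
    then show ?thesis by blast
  qed blast
qed

section \<open>Writing polynomials as compositions with a given inner polynomial\<close>

text \<open>The predicate \<open>Q\<close> stands for a symmetry shared by \<open>g\<close> and
  \<open>D\<close>. Divisibility of degrees lets a multiple of a power of \<open>D\<close> cancel
  the leading term of \<open>g\<close>; the remainder again satisfies \<open>Q\<close>.\<close>

lemma exists_pcompose_if_degree_dvd:
  fixes D g :: "'a::field poly"
  assumes D: "degree D > 0" "lead_coeff D = 1"
    and closed: "\<And>g c k. Q g \<Longrightarrow> Q (g - smult c (D ^ k))"
    and dvd: "\<And>g. Q g \<Longrightarrow> degree g > 0 \<Longrightarrow> degree D dvd degree g"
    and "Q g"
  shows "\<exists>G. g = G \<circ>\<^sub>p D"
  using \<open>Q g\<close>
proof (induction "degree g" arbitrary: g rule: less_induct)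
  case less
  show ?case
  proof (cases "degree g = 0")
    case True
    then obtain c where "g = [:c:]" by (rule degree_eq_zeroE)
    then have "g = [:c:] \<circ>\<^sub>p D" by simp
    then show ?thesis by blast
  next
    case False
    with dvd less.prems obtain k where k: "degree g = degree D * k" by auto
    define c where "c = lead_coeff g"
    have "c \<noteq> 0" "D \<noteq> 0" using False D by (auto simp: c_def)
    define T where "T = smult c (D ^ k)"
    have T: "degree T = degree g" "lead_coeff T = lead_coeff g"
      using \<open>c \<noteq> 0\<close> \<open>D \<noteq> 0\<close> k D
      using lead_coeff_power[of D k]
      by (simp_all add: T_def degree_power_eq c_def mult.commute)
    have "degree (g - T) < degree g"
    proof (rule degree_lessI)
      show "g - T \<noteq> 0 \<or> degree g > 0" using False by simp
      show "\<forall>i\<ge>degree g. coeff (g - T) i = 0"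
        using T by (metis coeff_diff coeff_eq_0 diff_self le_neq_implies_less)
    qed
    moreover have "Q (g - T)" using closed less.prems by (simp add: T_def)
    ultimately obtain G where G: "g - T = G \<circ>\<^sub>p D" using less.hyps by blast
    have pow: "monom 1 k \<circ>\<^sub>p D = D ^ k"
      by (induction k) (simp_all add: monom_Suc monom_0 pcompose_pCons pcompose_1 flip: one_pCons)
    have "g = (G + smult c (monom 1 k)) \<circ>\<^sub>p D"
      using G by (simp add: pcompose_add pcompose_smult pow T_def algebra_simps)
    then show ?thesis by blast
  qed
qed

lemma exists_pcompose_monom:
  fixes g :: "'a::field poly"
  assumes "s > 0" "\<And>j. coeff g j \<noteq> 0 \<Longrightarrow> s dvd j"
  shows "\<exists>G. g = G \<circ>\<^sub>p monom 1 s"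
proof (rule exists_pcompose_if_degree_dvd[where Q = "\<lambda>g. \<forall>j. coeff g j \<noteq> 0 \<longrightarrow> s dvd j"])
  fix g :: "'a poly" assume "\<forall>j. coeff g j \<noteq> 0 \<longrightarrow> s dvd j" "degree g > 0"
  then show "degree (monom (1 :: 'a) s) dvd degree g"
    by (metis degree_0 degree_monom_eq leading_coeff_0_iff less_numeral_extra(3) one_neq_zero)
qed (use assms in \<open>auto simp: degree_monom_eq monom_power coeff_monom split: if_splits\<close>)

section \<open>Dickson polynomials\<close>

lemma dickson_rat_compose:
  assumes "y \<notin> range rat_const"
  shows "to_fract (dickson k) \<circ>\<^sub>r (y + 1 / y) = y ^ k + 1 / y ^ k"
proof -
  have "to_fract (dickson k) \<circ>\<^sub>r (rat_X + 1 / rat_X) = rat_X ^ k + 1 / rat_X ^ k"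
    unfolding dickson_def by (rule theI'[OF dickson_ex1])
  then have "(to_fract (dickson k) \<circ>\<^sub>r (rat_X + 1 / rat_X)) \<circ>\<^sub>r y = (rat_X ^ k + 1 / rat_X ^ k) \<circ>\<^sub>r y"
    by simp
  then show ?thesis
    by (simp add: to_fract_rat_compose_assoc[OF assms] rat_compose_add[OF assms]
        rat_compose_divide[OF assms] rat_compose_power[OF assms])
qed

lemma dickson_eqI:
  "to_fract D \<circ>\<^sub>r (rat_X + 1 / rat_X) = rat_X ^ k + 1 / rat_X ^ k \<Longrightarrow> dickson k = D"
  unfolding dickson_def by (rule the1_equality[OF dickson_ex1])

lemma dickson_1: "dickson 1 = [:0, 1:]"
  by (rule dickson_eqI) (simp add: to_fract_rat_compose poly_const_pCons)

lemma dickson_0: "dickson 0 = [:2:]"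
  using rat_const_add[of 1 1]
  by (intro dickson_eqI) (simp add: to_fract_rat_compose poly_const_pCons)

text \<open>Multiplying \<open>x^(k+1) + x^-(k+1)\<close> by \<open>x + 1/x\<close> yields the
  expressions for \<open>k + 2\<close> and for \<open>k\<close>.\<close>

lemma dickson_Suc_Suc: "dickson (Suc (Suc k)) = [:0, 1:] * dickson (Suc k) - dickson k"
proof (rule dickson_eqI)
  note D = dickson_rat_compose[OF rat_X_notin_range, unfolded to_fract_rat_compose]
  show "to_fract ([:0, 1:] * dickson (Suc k) - dickson k) \<circ>\<^sub>r (rat_X + 1 / rat_X) =
    rat_X ^ Suc (Suc k) + 1 / rat_X ^ Suc (Suc k)"
    unfolding to_fract_rat_compose poly_const_diff poly_const_mult D
    by (simp add: poly_const_pCons field_simps)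
qed

text \<open>Restricted to successors because \<open>dickson 0\<close> is the constant 2, which is
  not monic.\<close>

lemma degree_dickson: "degree (dickson (Suc k)) = Suc k \<and> lead_coeff (dickson (Suc k)) = 1"
proof (induction k rule: less_induct)
  case (less k)
  show ?case
  proof (cases k)
    case 0
    then show ?thesis using dickson_1 by simp
  next
    case (Suc i)
    have IH: "degree (dickson (Suc i)) = Suc i" "lead_coeff (dickson (Suc i)) = 1"
      using less.IH[of i] Suc by auto
    then have ne: "dickson (Suc i) \<noteq> 0" by auto
    let ?p = "[:0, 1:] * dickson (Suc i)"
    have p: "degree ?p = Suc (Suc i)" "lead_coeff ?p = 1"
      using IH ne by (simp_all add: degree_mult_eq lead_coeff_mult)
    have "degree (dickson i) < Suc (Suc i)"
    proof (cases i)
      case 0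
      then show ?thesis by (simp add: dickson_0)
    next
      case (Suc i')
      then show ?thesis using less.IH[of i'] \<open>k = Suc i\<close> by simp
    qed
    moreover from this have "degree (?p - dickson i) = degree ?p"
      using p degree_add_eq_left[of "- dickson i" ?p] by simp
    ultimately show ?thesis
      using p unfolding Suc dickson_Suc_Suc by (simp add: coeff_eq_0)
  qed
qed

section \<open>Tools for normalizing the data and for divisibility\<close>

text \<open>Serves to choose the shift that removes the second highest coefficient. The bound on the
  degree, rather than an equality, lets the induction go through.\<close>

lemma coeff_pcompose_translate:
  fixes p :: "'a::comm_ring_1 poly"
  shows "degree p \<le> Suc n \<Longrightarrow>
      coeff (p \<circ>\<^sub>p [:a, 1:]) n = coeff p n + of_nat (Suc n) * a * coeff p (Suc n)"
proof -
  have top: "coeff (p \<circ>\<^sub>p [:a, 1:]) n = coeff p n" if "degree p \<le> n" for p :: "'a poly" and n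
    using that
  proof (induction p arbitrary: n)
    case (pCons b p)
    show ?case
    proof (cases n)
      case 0
      with pCons show ?thesis by (cases "p = 0") (auto simp: pcompose_pCons)
    next
      case (Suc k)
      with pCons have "degree p \<le> k" by (cases "p = 0") auto
      with pCons Suc show ?thesis
        by (simp add: pcompose_pCons coeff_eq_0)
    qed
  qed simp
  show "degree p \<le> Suc n \<Longrightarrow>
      coeff (p \<circ>\<^sub>p [:a, 1:]) n = coeff p n + of_nat (Suc n) * a * coeff p (Suc n)"
  proof (induction p arbitrary: n)
    case (pCons b p)
    then have "degree p \<le> n" by (cases "p = 0") auto
    with pCons.IH[of "n - 1"] top[of p n] show ?case
      by (cases n) (auto simp: pcompose_pCons algebra_simps)
  qed simp
qed

lemma exists_nth_root:
  fixes w :: complex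
  assumes "m > 0"
  shows "\<exists>z. z ^ m = w"
proof -
  let ?p = "monom 1 m - [:w:]"
  have "coeff ?p m = 1" using assms by (simp add: coeff_pCons split: nat.splits)
  then have "degree ?p \<noteq> 0" using assms by (metis le_degree less_le_not_le one_neq_zero)
  then obtain z where "poly ?p z = 0"
    using fundamental_theorem_of_algebra[of ?p] by (auto simp: constant_degree)
  then show ?thesis by (auto simp: poly_monom)
qed

text \<open>\<open>n\<close> divides both \<open>n * i\<close> and \<open>e * i\<close>, hence their
  gcd \<open>r * i\<close>; then \<open>r\<close> is cancelled. This turns
  \<open>(\<zeta> powi e) ^ i = 1\<close> into divisibility by the degree of
  \<open>G1\<close>.\<close>

lemma div_gcd_dvd:
  assumes "n > 0" "int r = gcd (int n) e" "int n dvd e * int i"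
  shows "n div r dvd i"
proof -
  have "int n dvd gcd (int n * int i) (e * int i)" using assms by simp
  also have "\<dots> = int (r * i)"
    using gcd_mult_left[of "int i" "int n" e] assms(2) by (simp add: abs_mult mult.commute)
  finally have "n dvd r * i" by (simp only: int_dvd_int_iff)
  moreover have "r dvd n" using assms by (metis gcd_dvd1 int_dvd_int_iff)
  moreover have "r > 0" using assms by (metis gcd_eq_0_iff gr0I of_nat_0 of_nat_eq_0_iff)
  ultimately show ?thesis by (auto elim!: dvdE)
qed

section \<open>Normalization, then the power case and the Dickson case\<close>

theorem theorem6p1:
  fixes g1 :: "complex poly" and g2 h1 :: ratfun and n :: nat
  assumes "to_fract g1 \<notin> range rat_const"
    and "g2 \<in> laurent_polys - range rat_const"
    and "h1 \<in> laurent_polys - range rat_const"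
    and "n > 0"
    and "to_fract g1 \<circ>\<^sub>r h1 = g2 \<circ>\<^sub>r rat_X ^ n"
  shows
    "(\<exists>A\<in>laurent_polys. h1 = A \<circ>\<^sub>r rat_X ^ n \<and> g2 = to_fract g1 \<circ>\<^sub>r A) \<or>
     (\<exists>(G :: complex poly) (\<mu> :: complex poly) (G1 :: complex poly) (H1 :: ratfun) (G2 :: ratfun)
        (e :: int) (r :: nat).
        linear_poly \<mu> \<and>
        g1 = G \<circ>\<^sub>p G1 \<circ>\<^sub>p \<mu> \<and>
        h1 = to_fract (comp_inv \<mu>) \<circ>\<^sub>r H1 \<and>
        g2 = to_fract G \<circ>\<^sub>r G2 \<and>
        int r = gcd (int n) e \<and>
        ((\<exists>p :: complex poly.
            G1 = monom 1 (n div r) \<and>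
            H1 = rat_X powi e * (to_fract p \<circ>\<^sub>r rat_X ^ n) \<and>
            G2 = rat_X powi (e div int r) * to_fract p ^ (n div r)) \<or>
         (\<exists>\<alpha> :: complex. \<alpha> \<noteq> 0 \<and>
            G1 = dickson (n div r) \<and>
            H1 = (rat_X powi e + 1 / rat_X powi e) \<circ>\<^sub>r (rat_const \<alpha> * rat_X) \<and>
            G2 = (rat_X powi (e div int r) + 1 / rat_X powi (e div int r))
                   \<circ>\<^sub>r (rat_const (\<alpha> ^ n) * rat_X))))"
proof -
  define d where "d = degree g1"
  have "d > 0"
    using assms(1) by (auto simp: d_def rat_const_def elim!: degree_eq_zeroE intro!: Nat.gr0I)
  \<comment> \<open>The shift that makes the coefficient of degree \<open>d - 1\<close> vanish;
    \<open>H0\<close> below undoes it on the inside.\<close>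
  define c0 where "c0 = coeff g1 (d - 1) / (of_nat d * lead_coeff g1)"
  define g0 where "g0 = g1 \<circ>\<^sub>p [:- c0, 1:]"
  have deg_g0: "degree g0 = d" by (simp add: g0_def d_def degree_pcompose)
  have "lead_coeff g1 \<noteq> 0" using \<open>d > 0\<close> by (auto simp: d_def)
  then have coeff_g0: "coeff g0 (d - 1) = 0"
    using \<open>d > 0\<close> coeff_pcompose_translate[of g1 "d - 1" "- c0"]
    by (simp add: g0_def c0_def flip: d_def)
  have g1_g0: "g1 = g0 \<circ>\<^sub>p [:c0, 1:]"
    by (simp add: g0_def pcompose_pCons pcompose_idR flip: pcompose_assoc)

  define H0 where "H0 = h1 + rat_const c0"
  have H0: "H0 \<notin> range rat_const"
  proof
    assume "H0 \<in> range rat_const"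
    then obtain c where "h1 + rat_const c0 = rat_const c" by (auto simp: H0_def)
    then have "h1 = rat_const (c - c0)"
      using rat_const_add[of "c - c0" c0] by simp
    with assms(3) show False by auto
  qed
  have g0_H0: "to_fract g0 \<circ>\<^sub>r H0 = g2 \<circ>\<^sub>r rat_X ^ n"
    by (simp add: g0_def to_fract_pcompose_rat_compose to_fract_rat_compose[of "[:- c0, 1:]"]
        poly_const_pCons H0_def rat_const_minus assms(5))

  \<comment> \<open>All powers of \<open>x\<close> are moved into \<open>l\<close>, so that
    \<open>l\<close> is the lowest exponent of \<open>H0\<close>.\<close>
  obtain F l where H0_eq: "H0 = rat_X powi l * to_fract F" and F0: "coeff F 0 \<noteq> 0"
  proof -
    obtain F0 k where h1: "h1 = to_fract F0 / rat_X ^ k"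
      using assms(3) by (auto simp: laurent_polys_def)
    define F1 where "F1 = F0 + monom c0 k"
    have H01: "H0 = to_fract F1 / rat_X ^ k"
      by (simp add: H0_def h1 F1_def to_fract_monom add_divide_distrib)
    with H0 have "F1 \<noteq> 0" by (metis div_0 rangeI rat_const_0 to_fract_0)
    from order_decomp[OF this, of 0] obtain F a where
      F: "F1 = monom 1 a * F" "\<not> [:0, 1:] dvd F"
      by (auto simp: monom_altdef)
    have "H0 = rat_X powi (int a - int k) * to_fract F"
      using H01 by (simp add: F power_int_diff to_fract_monom)
    moreover have "coeff F 0 \<noteq> 0"
      using F(2) poly_eq_0_iff_dvd[of F 0] by (simp add: poly_0_coeff_0)
    ultimately show ?thesis using that by blast
  qed
  have "F \<noteq> 0" using F0 by auto

  obtain \<zeta> :: complex where \<zeta>: "\<And>j. \<zeta> ^ j = 1 \<longleftrightarrow> n dvd j"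
    using exists_primitive_root_of_unity[OF assms(4)] by blast
  have "\<zeta> \<noteq> 0" using \<zeta>[of n] assms(4) by (auto simp: power_0_left)
  define Z where "Z = rat_const \<zeta> * rat_X"
  have Z: "Z \<notin> range rat_const"
    using const_mult_rat_X_notin_range \<open>\<zeta> \<noteq> 0\<close> by (simp add: Z_def)
  have Xn: "rat_X ^ n \<notin> range rat_const"
    using rat_X_power_notin_range[OF assms(4), of 1] by simp
  have Xn_Z: "rat_X ^ n \<circ>\<^sub>r Z = rat_X ^ n"
    using \<zeta>[of n] unfolding rat_compose_power[OF Z]
    by (simp add: Z_def power_mult_distrib flip: rat_const_power)
  \<comment> \<open>\<open>Z\<close> fixes \<open>rat_X ^ n\<close>, hence also \<open>g2\<close>
    composed with it.\<close>
  have inv: "to_fract g0 \<circ>\<^sub>r (H0 \<circ>\<^sub>r Z) = to_fract g0 \<circ>\<^sub>r H0"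
    by (simp add: g0_H0 rat_compose_assoc[OF Z Xn] Xn_Z flip: to_fract_rat_compose_assoc[OF Z])

  from support_of_symmetric_laurent[OF H0_eq H0 F0 \<open>\<zeta> \<noteq> 0\<close>, of g0]
    deg_g0 \<open>d > 0\<close> coeff_g0 inv[unfolded Z_def]
  consider (power) "\<And>j. coeff F j \<noteq> 0 \<Longrightarrow> n dvd j"
    | (dickson) m where "m > 0" "l = - int m" "degree F = 2 * m"
        "\<And>j. 0 < j \<Longrightarrow> j < 2 * m \<Longrightarrow> coeff F j = 0"
    using \<zeta> by auto
  then show ?thesis
  proof cases
    case power
    define r where "r = nat (gcd (int n) l)"
    define s where "s = n div r"
    have r: "int r = gcd (int n) l" by (simp add: r_def)
    have "r dvd n" "int r dvd l" using r by (metis gcd_dvd1 int_dvd_int_iff, metis gcd_dvd2)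
    then have n: "n = r * s" by (simp add: s_def)
    then have "s > 0" using assms(4) by (cases s) auto
    obtain p where p: "F = p \<circ>\<^sub>p monom 1 n"
      using exists_pcompose_monom[OF assms(4), of F] power by blast
    have F_p: "to_fract F = to_fract p \<circ>\<^sub>r rat_X ^ n"
      using to_fract_rat_compose_to_fract[of p "monom 1 n"] by (simp add: p to_fract_monom)
    have "F = F \<circ>\<^sub>p [:0, \<zeta>:]"
      using power \<zeta> by (intro poly_eqI) (auto simp: coeff_pcompose_linear)
    moreover have "Z = to_fract [:0, \<zeta>:]"
      using to_fract_monom[of \<zeta> 1] by (simp add: Z_def monom_altdef)
    ultimately have F_Z: "to_fract F \<circ>\<^sub>r Z = to_fract F"
      by (metis to_fract_rat_compose_to_fract)
    \<comment> \<open>All exponents of \<open>H0\<close> are congruent to \<open>l\<close> modulo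
      \<open>n\<close>, so the substitution \<open>Z\<close> just multiplies \<open>H0\<close> by
      \<open>\<eta>\<close>; cancelling \<open>H0\<close> makes \<open>g0\<close> invariant under
      scaling by \<open>\<eta>\<close>.\<close>
    define \<eta> where "\<eta> = \<zeta> powi l"
    have "rat_const \<zeta> powi l = rat_const \<eta>"
      by (simp add: \<eta>_def power_int_def rat_const_power rat_const_inverse)
    then have "H0 \<circ>\<^sub>r Z = rat_const \<eta> * H0"
      unfolding H0_eq rat_compose_mult[OF Z] rat_compose_power_int[OF Z] F_Z
      by (simp add: Z_def power_int_mult_distrib)
    then have "to_fract g0 \<circ>\<^sub>r H0 = to_fract (g0 \<circ>\<^sub>p [:0, \<eta>:]) \<circ>\<^sub>r H0"
      using inv
      by (simp add: to_fract_pcompose_rat_compose to_fract_rat_compose[of "[:0, \<eta>:]"]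
          poly_const_pCons mult.commute)
    then have g0_eta: "g0 = g0 \<circ>\<^sub>p [:0, \<eta>:]" by (simp only: to_fract_rat_compose_inject[OF H0])
    have "s dvd i" if "coeff g0 i \<noteq> 0" for i
    proof -
      have "\<eta> ^ i * coeff g0 i = coeff g0 i" by (metis g0_eta coeff_pcompose_linear)
      with that have "\<eta> ^ i = 1" by simp
      then have "int n dvd l * int i"
        using power_int_eq_1_iff_dvd[OF \<zeta>] by (simp add: \<eta>_def power_int_power')
      then show "s dvd i" using div_gcd_dvd[OF assms(4) r] by (simp add: s_def)
    qed
    then obtain G where G: "g0 = G \<circ>\<^sub>p monom 1 s"
      using exists_pcompose_monom[OF \<open>s > 0\<close>] by blast
    define G2 where "G2 = rat_X powi (l div int r) * to_fract p ^ s"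
    \<comment> \<open>Since \<open>l * s\<close> is \<open>n\<close> times \<open>l div r\<close>,
      the power \<open>H0 ^ s\<close> involves \<open>x\<close> only through
      \<open>x^n\<close>.\<close>
    have "H0 ^ s = G2 \<circ>\<^sub>r rat_X ^ n"
    proof -
      have "int n * (l div int r) = l * int s"
        using \<open>int r dvd l\<close> n by (auto simp: mult_ac elim!: dvdE)
      then show ?thesis
        unfolding H0_eq G2_def rat_compose_mult[OF Xn] rat_compose_power_int[OF Xn]
          rat_compose_power[OF Xn] F_p
        by (simp add: power_mult_distrib power_int_power power_int_power')
    qed
    then have "g2 \<circ>\<^sub>r rat_X ^ n = (to_fract G \<circ>\<^sub>r G2) \<circ>\<^sub>r rat_X ^ n"
      unfolding g0_H0[symmetric] G to_fract_pcompose_rat_compose to_fract_rat_compose_assoc[OF Xn]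
      by (simp add: to_fract_monom rat_compose_power[OF H0])
    then have "g2 = to_fract G \<circ>\<^sub>r G2" by (simp only: rat_compose_eq_iff[OF Xn])
    moreover have "h1 = to_fract (comp_inv [:c0, 1:]) \<circ>\<^sub>r H0"
      by (simp add: comp_inv_linear to_fract_rat_compose poly_const_pCons H0_def rat_const_minus)
    moreover have "g1 = G \<circ>\<^sub>p monom 1 s \<circ>\<^sub>p [:c0, 1:]" by (simp add: g1_g0 G)
    moreover have "linear_poly [:c0, 1:]" by (simp add: linear_poly_def)
    moreover have "H0 = rat_X powi l * (to_fract p \<circ>\<^sub>r rat_X ^ n)" by (simp add: H0_eq F_p)
    ultimately show ?thesis using r unfolding G2_def s_def by blast
  next
    case (dickson m)
    define r where "r = nat (gcd (int n) (int m))"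
    define s where "s = n div r"
    have r: "int r = gcd (int n) (int m)" by (simp add: r_def)
    have "r dvd n" "r dvd m" using r by (metis gcd_dvd1 int_dvd_int_iff, metis gcd_dvd2 int_dvd_int_iff)
    then have n: "n = r * s" by (simp add: s_def)
    then have "s > 0" using assms(4) by (cases s) auto
    have "r > 0" using n assms(4) by (cases r) auto
    have nm: "n * (m div r) = m * s" using \<open>r dvd m\<close> \<open>r > 0\<close> n by (auto elim!: dvdE)
    define a where "a = lead_coeff F"
    define b where "b = coeff F 0"
    have ab: "a \<noteq> 0" "b \<noteq> 0" using F0 \<open>F \<noteq> 0\<close> by (auto simp: a_def b_def)
    have F_ab: "F = monom a (2 * m) + [:b:]"
    proof (rule poly_eqI)
      fix j
      consider "j = 0" | "0 < j" "j < 2 * m" | "j = 2 * m" | "j > 2 * m" by linarith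
      then show "coeff F j = coeff (monom a (2 * m) + [:b:]) j"
        using dickson by cases (auto simp: a_def b_def coeff_pCons coeff_eq_0 split: nat.splits)
    qed
    \<comment> \<open>\<open>H0\<close> is \<open>a x^m + b x^-m\<close>. To write it as
      \<open>c * (Y ^ m + 1 / Y ^ m)\<close> with \<open>Y = \<alpha> x\<close>, one needs
      \<open>c \<alpha>^m = a\<close> and \<open>c / \<alpha>^m = b\<close>; the product of these
      fixes the square of \<open>c\<close>.\<close>
    define c where "c = csqrt (a * b)"
    have c2: "c\<^sup>2 = a * b" by (simp add: c_def)
    then have "c \<noteq> 0" using ab by auto
    obtain \<alpha> where \<alpha>: "\<alpha> ^ m = a / c" using exists_nth_root[OF dickson(1)] by blast
    then have "\<alpha> \<noteq> 0" using ab \<open>c \<noteq> 0\<close> dickson(1) by (auto simp: power_0_left split: if_splits)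
    define Y where "Y = rat_const \<alpha> * rat_X"
    have Y: "Y \<notin> range rat_const"
      using const_mult_rat_X_notin_range \<open>\<alpha> \<noteq> 0\<close> by (simp add: Y_def)
    have Y_pow: "Y ^ k = rat_const (\<alpha> ^ k) * rat_X ^ k" for k
      by (simp add: Y_def power_mult_distrib rat_const_power)
    have Y_pow_range: "Y ^ k \<notin> range rat_const" if "k > 0" for k
      unfolding Y_pow using that \<open>\<alpha> \<noteq> 0\<close> by (intro rat_X_power_notin_range) auto
    define H where "H = Y ^ m + 1 / Y ^ m"
    have H_H0: "H0 = rat_const c * H"
    proof -
      have "c * \<alpha> ^ m = a" "c / \<alpha> ^ m = b"
        using \<alpha> c2 \<open>c \<noteq> 0\<close> ab by (simp_all add: power2_eq_square)
      then have "rat_const c * rat_const (\<alpha> ^ m) = rat_const a"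
        "rat_const c / rat_const (\<alpha> ^ m) = rat_const b"
        by (simp_all flip: rat_const_mult rat_const_divide)
      moreover have "rat_const c * H =
        (rat_const c * rat_const (\<alpha> ^ m)) * rat_X ^ m + (rat_const c / rat_const (\<alpha> ^ m)) / rat_X ^ m"
        by (simp add: H_def Y_pow algebra_simps)
      moreover have "inverse (rat_X ^ m) * rat_X ^ (m * 2) = rat_X ^ m"
        by (simp add: mult_2_right power_add)
      moreover have "to_fract [:b:] = rat_const b" by (simp add: rat_const_def)
      ultimately show ?thesis
        by (simp add: H0_eq F_ab to_fract_monom dickson(2) power_int_minus divide_inverse
            power_add mult_2 algebra_simps)
    qed
    have H: "H \<notin> range rat_const"
    proof
      assume "H \<in> range rat_const"
      then have "H0 \<in> range rat_const" by (auto simp: H_H0 simp flip: rat_const_mult)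
      with H0 show False by blast
    qed
    \<comment> \<open>The factor \<open>c\<close> is absorbed into the outer polynomial.\<close>
    define g where "g = g0 \<circ>\<^sub>p [:0, c:]"
    have g_H: "to_fract g \<circ>\<^sub>r H = to_fract g0 \<circ>\<^sub>r H0"
      by (simp add: g_def to_fract_pcompose_rat_compose to_fract_rat_compose[of "[:0, c:]"]
          poly_const_pCons H_H0 mult.commute)
    define D where "D = dickson s"
    have degD: "degree D = s" "lead_coeff D = 1"
      using degree_dickson[of "s - 1"] \<open>s > 0\<close> by (auto simp: D_def)
    have D_H: "to_fract D \<circ>\<^sub>r H = Y ^ (m * s) + 1 / Y ^ (m * s)"
      unfolding D_def H_def
      using dickson_rat_compose[OF Y_pow_range[OF dickson(1)], of s] by (simp add: power_mult)
    \<comment> \<open>Hence \<open>Z\<close> fixes \<open>Y ^ (m * s)\<close>, so \<open>D\<close>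
      composed with \<open>H\<close> has the same symmetry as \<open>g\<close> composed with
      \<open>H\<close>.\<close>
    have "n dvd m * s" using nm by (metis dvd_triv_left)
    then have "\<zeta> ^ (m * s) = 1" using \<zeta> by blast
    then have zms: "rat_const \<zeta> ^ (m * s) = 1" by (metis rat_const_1 rat_const_power)
    have "Y ^ (m * s) \<circ>\<^sub>r Z = Y ^ (m * s)"
      unfolding Y_pow rat_compose_mult[OF Z] rat_compose_power[OF Z]
      by (simp add: Z_def power_mult_distrib zms)
    then have D_inv: "to_fract D \<circ>\<^sub>r (H \<circ>\<^sub>r Z) = to_fract D \<circ>\<^sub>r H"
      unfolding to_fract_rat_compose_assoc[OF Z, symmetric] D_H rat_compose_add[OF Z]
        rat_compose_divide[OF Z] by simp
    have H_F: "H = rat_X powi l * to_fract (smult (1 / c) F)"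
    proof -
      have "to_fract (smult (1 / c) F) = rat_const (1 / c) * to_fract F"
        by (simp add: rat_const_def flip: to_fract_mult)
      moreover have "H = rat_const (1 / c) * H0"
        using \<open>c \<noteq> 0\<close> by (simp add: H_H0 rat_const_divide)
      ultimately show ?thesis by (simp add: H0_eq mult_ac)
    qed
    have "\<exists>G. g = G \<circ>\<^sub>p D"
    proof (rule exists_pcompose_if_degree_dvd[where
          Q = "\<lambda>g. to_fract g \<circ>\<^sub>r (H \<circ>\<^sub>r Z) = to_fract g \<circ>\<^sub>r H"])
      show "degree D > 0" "lead_coeff D = 1" using degD \<open>s > 0\<close> by simp_all
      show "to_fract g \<circ>\<^sub>r (H \<circ>\<^sub>r Z) = to_fract g \<circ>\<^sub>r H"
        using inv unfolding g_H[symmetric] to_fract_rat_compose_assoc[OF Z, symmetric]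
        by (simp only: g_H)
    next
      fix f c k assume f: "to_fract f \<circ>\<^sub>r (H \<circ>\<^sub>r Z) = to_fract f \<circ>\<^sub>r H"
      have pow: "poly (map_poly rat_const (D ^ k)) x = poly (map_poly rat_const D) x ^ k" for x
        by (induction k) (simp_all add: poly_const_mult poly_const_1)
      show "to_fract (f - smult c (D ^ k)) \<circ>\<^sub>r (H \<circ>\<^sub>r Z) = to_fract (f - smult c (D ^ k)) \<circ>\<^sub>r H"
        using f D_inv unfolding to_fract_rat_compose
        by (simp add: poly_const_diff poly_const_smult pow)
    next
      fix f assume f: "to_fract f \<circ>\<^sub>r (H \<circ>\<^sub>r Z) = to_fract f \<circ>\<^sub>r H" "degree f > 0"
      \<comment> \<open>The pole order of \<open>H\<close> at infinity is
        \<open>2 * m - m = m\<close>, so \<open>n\<close> divides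
        \<open>m * degree f\<close>.\<close>
      have "(\<zeta> powi (int (degree (smult (1 / c) F)) + l)) ^ degree f = 1"
        using \<open>c \<noteq> 0\<close> \<open>F \<noteq> 0\<close> \<open>\<zeta> \<noteq> 0\<close> f dickson(1-3)
        by (intro leading_exponent_symmetry[OF H_F]) (simp_all add: Z_def)
      then have "\<zeta> ^ (m * degree f) = 1"
        using \<open>c \<noteq> 0\<close> dickson(2,3) by (simp add: power_mult)
      then have "int n dvd int m * int (degree f)"
        using \<zeta> by (simp flip: of_nat_mult)
      then show "degree D dvd degree f"
        using div_gcd_dvd[OF assms(4) r] by (simp add: degD s_def)
    qed
    then obtain G where G: "g = G \<circ>\<^sub>p D" by blast
    \<comment> \<open>Chosen so that \<open>\<mu>\<close> applied to \<open>h1\<close> is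
      \<open>(h1 + c0) / c\<close>, that is \<open>H\<close>.\<close>
    define \<mu> where "\<mu> = [:c0 / c, 1 / c:]"
    define G2 where "G2 = (rat_X powi (int m div int r) + 1 / rat_X powi (int m div int r))
                   \<circ>\<^sub>r (rat_const (\<alpha> ^ n) * rat_X)"
    \<comment> \<open>Substituting \<open>x^n\<close> turns \<open>\<alpha>^n x\<close> into
      \<open>Y ^ n\<close>, whose power \<open>m div r\<close> is \<open>Y ^ (m * s)\<close>; the
      result is \<open>D\<close> composed with \<open>H\<close>.\<close>
    have "G2 \<circ>\<^sub>r rat_X ^ n = Y ^ (m * s) + 1 / Y ^ (m * s)"
    proof -
      let ?V = "rat_const (\<alpha> ^ n) * rat_X"
      have V: "?V \<notin> range rat_const" using const_mult_rat_X_notin_range \<open>\<alpha> \<noteq> 0\<close> by simp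
      have "?V \<circ>\<^sub>r rat_X ^ n = Y ^ n" by (simp add: rat_compose_mult[OF Xn] Y_pow)
      moreover have "G2 = ?V ^ (m div r) + 1 / ?V ^ (m div r)"
        unfolding G2_def rat_compose_add[OF V] rat_compose_divide[OF V] rat_compose_power_int[OF V]
        by (simp flip: zdiv_int)
      ultimately have "G2 \<circ>\<^sub>r rat_X ^ n = (Y ^ n) ^ (m div r) + 1 / (Y ^ n) ^ (m div r)"
        by (simp add: rat_compose_add[OF Xn] rat_compose_divide[OF Xn] rat_compose_power[OF Xn])
      then show ?thesis by (simp add: nm flip: power_mult)
    qed
    then have "g2 \<circ>\<^sub>r rat_X ^ n = (to_fract G \<circ>\<^sub>r G2) \<circ>\<^sub>r rat_X ^ n"
      by (simp add: D_H G to_fract_pcompose_rat_compose to_fract_rat_compose_assoc[OF Xn]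
          flip: g0_H0 g_H)
    then have g2_eq: "g2 = to_fract G \<circ>\<^sub>r G2" by (simp only: rat_compose_eq_iff[OF Xn])
    have h1_eq: "h1 = to_fract (comp_inv \<mu>) \<circ>\<^sub>r H"
    proof -
      have "comp_inv \<mu> = [:- c0, c:]" using \<open>c \<noteq> 0\<close> by (simp add: \<mu>_def comp_inv_linear)
      moreover have "h1 = rat_const c * H - rat_const c0" by (simp add: H0_def flip: H_H0)
      ultimately show ?thesis
        by (simp add: to_fract_rat_compose poly_const_pCons rat_const_minus)
    qed
    have g1_eq: "g1 = G \<circ>\<^sub>p D \<circ>\<^sub>p \<mu>"
    proof -
      have "[:0, c:] \<circ>\<^sub>p \<mu> = [:c0, 1:]" using \<open>c \<noteq> 0\<close> by (simp add: \<mu>_def pcompose_pCons)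
      then show ?thesis unfolding G[symmetric] g_def g1_g0 by (metis pcompose_assoc)
    qed
    have linear: "linear_poly \<mu>" using \<open>c \<noteq> 0\<close> by (simp add: linear_poly_def \<mu>_def)
    have H_eq: "H = (rat_X powi int m + 1 / rat_X powi int m) \<circ>\<^sub>r (rat_const \<alpha> * rat_X)"
      using Y by (simp add: H_def rat_compose_add rat_compose_divide rat_compose_power flip: Y_def)
    show ?thesis
      by (rule disjI2, rule exI[of _ G], rule exI[of _ \<mu>], rule exI[of _ D], rule exI[of _ H],
          rule exI[of _ G2], rule exI[of _ "int m"], rule exI[of _ r],
          intro conjI disjI2 exI[of _ \<alpha>])
        (fact linear g1_eq h1_eq g2_eq r \<open>\<alpha> \<noteq> 0\<close> H_eq D_def[unfolded s_def] G2_def)+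
  qed
qed

end
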